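(* Let $n=(n_x : x\in J_L)$ be an $\ell$-way contingency table, let $\mathcal{L}$ be the lattice of all subsets of $L=\{1,\dots,\ell\}$, and let $n(\cdot)$ be the marginalization function of the table. Then: (a) $n(\cdot)$ is decreasing on $\mathcal{L}$, i.e., $n(a)\geq n(b)$ for all $a,b\in\mathcal{L}$ with $a\subset b$; and (b) $n(\cdot)$ is supermodular on $\mathcal{L}$, i.e., $n(a\cup b)+n(a\cap b)\geq n(a)+n(b)$ for all $a,b\in\mathcal{L}$. Both inequalities are understood cellwise, i.e., they hold for the corresponding marginal entries at every $x\in J_L$.
   Context: Let $L=\{1,\dots,\ell\}$ and let $\mathcal{L}$ be the set of all subsets of $L$, partially ordered by inclusion $\subset$ (not necessarily strict), with meet $\cap$ and join $\cup$. For each $j\in L$ let $I_j$ be a discrete (finite or countable) set of labels, and put $J_L=I_1\times\cdots\times I_\ell$. For $a=\{i_1,\dots,i_p\}\subset L$ put $J_a=I_{i_1}\times\cdots\times I_{i_p}$; each $x\in J_L$ is written $x=(x_a,x_{L\setminus a})$ with $x_a\in J_a$, $x_{L\setminus a}\in J_{L\setminus a}$. An $\ell$-way contingency table is a family $n=(n_x:x\in J_L)$ of non-negative real numbers (typically counts) with finite total sum. The marginalization function assigns to $a\subset L$ the marginal table $n(a)=(n_{x(a),+}: x_a\in J_a)$, where $n_{x(a),+}=\sum_{y\in J_{L\setminus a}} n_{(x_a,y)}$ is obtained by summing over all coordinates outside $a$. In particular $n(L)=n$ is the table itself and $n(\emptyset)=\sum_{x\in J_L} n_x$ is the total. Convention: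 indices are omitted in a statement that holds for all choices of indices. An inequality among the marginal tables $n(a)$, for various $a$, means that for every fixed $x\in J_L$ the inequality holds with each $n(a)$ replaced by the number $n_{x(a),+}$. *)

theory Defs
  imports "HOL-Analysis.Analysis"
begin

text \<open>
  The label sets are a family \<open>I :: nat \<Rightarrow> 'i set\<close> of subsets of one type, and \<open>J_a\<close> is the
  extensional product \<open>Pi\<^sub>E a I\<close>, so that the projection of a cell \<open>x\<close> to the coordinates
  in \<open>a\<close> is \<open>restrict x a\<close>.
\<close>

definition axes :: "nat \<Rightarrow> nat set" where
  "axes l = {1..l}"

abbreviation cells :: "(nat \<Rightarrow> 'i set) \<Rightarrow> nat set \<Rightarrow> (nat \<Rightarrow> 'i) set" where
  "cells I a \<equiv> Pi\<^sub>E a I"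

text \<open>Values of \<open>n\<close> outside \<open>cells I (axes l)\<close> are irrelevant.\<close>

definition contingency_table ::
    "nat \<Rightarrow> (nat \<Rightarrow> 'i set) \<Rightarrow> ((nat \<Rightarrow> 'i) \<Rightarrow> real) \<Rightarrow> bool" where
  "contingency_table l I n \<longleftrightarrow>
     (\<forall>x\<in>cells I (axes l). 0 \<le> n x) \<and> n summable_on cells I (axes l)"

text \<open>
  The entry at \<open>u \<in> J_a\<close> of the marginal table \<open>n(a)\<close>; \<open>merge\<close> builds the cell \<open>(u, y)\<close> from
  \<open>u \<in> J_a\<close> and \<open>y \<in> J_(L - a)\<close>.
\<close>

definition marginal ::
    "nat \<Rightarrow> (nat \<Rightarrow> 'i set) \<Rightarrow> ((nat \<Rightarrow> 'i) \<Rightarrow> real) \<Rightarrow> nat set \<Rightarrow> (nat \<Rightarrow> 'i) \<Rightarrow> real" where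
  "marginal l I n a u =
     (\<Sum>\<^sub>\<infinity>y\<in>cells I (axes l - a). n (merge a (axes l - a) (u, y)))"

lemma marginal_axes:
  assumes "x \<in> cells I (axes l)"
  shows "marginal l I n (axes l) x = n x"
proof -
  have "merge (axes l) {} (x, \<lambda>_. undefined) = x"
    using assms by (auto simp: merge_def fun_eq_iff PiE_def extensional_def)
  then show ?thesis
    by (simp add: marginal_def)
qed

lemma marginal_empty:
  "marginal l I n {} u = (\<Sum>\<^sub>\<infinity>x\<in>cells I (axes l). n x)"
proof -
  have "merge {} (axes l) (u, y) = y" if "y \<in> cells I (axes l)" for y
    using that by (auto simp: merge_def fun_eq_iff PiE_def extensional_def)
  then show ?thesis
    by (auto simp: marginal_def intro!: infsum_cong)
qed

end

theory Submission
  imports Defs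
begin

text \<open>
  The entry of \<open>n(a)\<close> at \<open>x\<close> is the mass that the measure with density \<open>n\<close> gives to the cylinder
  of all cells agreeing with \<open>x\<close> on \<open>a\<close>. Cylinders shrink as \<open>a\<close> grows, which gives (a). The
  cylinder over \<open>a \<union> b\<close> is the intersection of those over \<open>a\<close> and \<open>b\<close>, and the cylinder over
  \<open>a \<inter> b\<close> contains their union, so (b) is the modularity of a measure plus monotonicity.
\<close>

definition cylinder :: "nat \<Rightarrow> (nat \<Rightarrow> 'i set) \<Rightarrow> nat set \<Rightarrow> (nat \<Rightarrow> 'i) \<Rightarrow> (nat \<Rightarrow> 'i) set" where
  "cylinder l I a x = {z \<in> cells I (axes l). \<forall>i\<in>a. z i = x i}"

lemma cylinder_antimono: "a \<subseteq> b \<Longrightarrow> cylinder l I b x \<subseteq> cylinder l I a x"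
  by (auto simp: cylinder_def)

lemma cylinder_Un: "cylinder l I (a \<union> b) x = cylinder l I a x \<inter> cylinder l I b x"
  by (auto simp: cylinder_def)

text \<open>A cell agreeing with \<open>x\<close> on \<open>a\<close> is determined by its other
  coordinates, so restriction to \<open>axes l - a\<close> is the inverse map.\<close>

lemma bij_betw_merge_cylinder:
  assumes "a \<subseteq> axes l" "x \<in> cells I (axes l)"
  shows "bij_betw (\<lambda>y. merge a (axes l - a) (restrict x a, y))
           (cells I (axes l - a)) (cylinder l I a x)"
proof (rule bij_betw_byWitness[where f' = "\<lambda>z. restrict z (axes l - a)"])
  show "\<forall>y\<in>cells I (axes l - a).
      restrict (merge a (axes l - a) (restrict x a, y)) (axes l - a) = y"
    by (auto simp: merge_def fun_eq_iff PiE_def extensional_def)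
  show "\<forall>z\<in>cylinder l I a x.
      merge a (axes l - a) (restrict x a, restrict z (axes l - a)) = z"
    using assms by (auto simp: cylinder_def merge_def fun_eq_iff PiE_def extensional_def)
  show "(\<lambda>y. merge a (axes l - a) (restrict x a, y)) ` cells I (axes l - a)
      \<subseteq> cylinder l I a x"
    using assms by (auto simp: cylinder_def merge_def PiE_def extensional_def Pi_def)
  show "(\<lambda>z. restrict z (axes l - a)) ` cylinder l I a x \<subseteq> cells I (axes l - a)"
    by (auto simp: cylinder_def)
qed

text \<open>Marginals for different \<open>a\<close> sum over different index spaces; as sums of
  \<open>n\<close> over subsets of one space they become comparable.\<close>

lemma marginal_eq_infsum_cylinder:
  assumes "a \<subseteq> axes l" "x \<in> cells I (axes l)"
  shows "marginal l I n a (restrict x a) = infsum n (cylinder l I a x)"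
  unfolding marginal_def by (rule infsum_reindex_bij_betw[OF bij_betw_merge_cylinder[OF assms]])

lemma contingency_table_summable_on:
  fixes n :: "(nat \<Rightarrow> 'i) \<Rightarrow> real"
  assumes "contingency_table l I n" "S \<subseteq> cells I (axes l)"
  shows "n summable_on S"
  using assms summable_on_subset_banach unfolding contingency_table_def by blast

text \<open>Passing from \<open>S\<close> to \<open>T\<close> only adds nonnegative terms.
  Summability matters, since \<open>infsum\<close> defaults to 0 on a non-summable family.\<close>

lemma contingency_table_infsum_mono:
  fixes n :: "(nat \<Rightarrow> 'i) \<Rightarrow> real"
  assumes "contingency_table l I n" "S \<subseteq> T" "T \<subseteq> cells I (axes l)"
  shows "infsum n S \<le> infsum n T"
proof (rule infsum_mono_neutral)
  show "n summable_on S" "n summable_on T"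
    using assms contingency_table_summable_on by blast+
qed (use assms in \<open>auto simp: contingency_table_def\<close>)

theorem theorem2p1:
  fixes l :: nat
    and I :: "nat \<Rightarrow> 'i set"
    and n :: "(nat \<Rightarrow> 'i) \<Rightarrow> real"
  assumes "\<And>j. j \<in> axes l \<Longrightarrow> countable (I j)"
    and "contingency_table l I n"
  shows "(\<forall>a\<in>Pow (axes l). \<forall>b\<in>Pow (axes l). a \<subseteq> b \<longrightarrow>
            (\<forall>x\<in>cells I (axes l).
               marginal l I n a (restrict x a) \<ge> marginal l I n b (restrict x b)))
       \<and> (\<forall>a\<in>Pow (axes l). \<forall>b\<in>Pow (axes l).
            (\<forall>x\<in>cells I (axes l).
               marginal l I n (a \<union> b) (restrict x (a \<union> b))
                 + marginal l I n (a \<inter> b) (restrict x (a \<inter> b))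
               \<ge> marginal l I n a (restrict x a) + marginal l I n b (restrict x b)))"
proof (intro conjI ballI impI)
  have cyl: "cylinder l I c x \<subseteq> cells I (axes l)" for c and x :: "nat \<Rightarrow> 'i"
    by (auto simp: cylinder_def)
  note mono = contingency_table_infsum_mono[OF assms(2) _ cyl]
  fix a b x
  assume ab: "a \<in> Pow (axes l)" "b \<in> Pow (axes l)" and x: "x \<in> cells I (axes l)"
  have marg: "marginal l I n c (restrict x c) = infsum n (cylinder l I c x)"
    if "c \<subseteq> axes l" for c
    using that x by (rule marginal_eq_infsum_cylinder)
  show "marginal l I n a (restrict x a) \<ge> marginal l I n b (restrict x b)" if "a \<subseteq> b"
    using ab that by (simp add: marg mono cylinder_antimono)
  let ?A = "cylinder l I a x" and ?B = "cylinder l I b x"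
  \<comment> \<open>These are the disjoint pieces of \<open>?A \<union> ?B\<close>; their
    summability licenses inclusion-exclusion for infinite sums.\<close>
  have sum: "n summable_on ?A - ?B" "n summable_on ?B - ?A" "n summable_on ?A \<inter> ?B"
    by (rule contingency_table_summable_on[OF assms(2)]; use cyl in blast)+
  have "infsum n ?A + infsum n ?B = infsum n (?A \<union> ?B) + infsum n (?A \<inter> ?B)"
    using infsum_Un_Int[OF sum] by simp
  \<comment> \<open>The only inequality in (b): a cell agreeing with \<open>x\<close> on
    \<open>a \<inter> b\<close> may differ from \<open>x\<close> both somewhere on \<open>a\<close>
    and somewhere on \<open>b\<close>.\<close>
  moreover have "infsum n (?A \<union> ?B) \<le> infsum n (cylinder l I (a \<inter> b) x)"
    by (intro mono Un_least cylinder_antimono) auto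
  moreover have "a \<union> b \<subseteq> axes l" "a \<inter> b \<subseteq> axes l"
    using ab by auto
  ultimately show "marginal l I n (a \<union> b) (restrict x (a \<union> b))
      + marginal l I n (a \<inter> b) (restrict x (a \<inter> b))
      \<ge> marginal l I n a (restrict x a) + marginal l I n b (restrict x b)"
    using ab by (simp add: marg cylinder_Un)
qed

end
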